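(* Let $a,b,c\ge 0$ be real numbers and let $$c_0:=\frac{a^2+b^2}{2(a+b)},$$ with the convention that $\frac{0}{0}=0$ and $\frac{\varepsilon}{0}=\infty$ for any $\varepsilon>0$. Then $$\mathcal{M}^*(a,b,c)=\begin{cases}\dfrac{a^2+b^2}{2c} & \text{if } 0\le c\le c_0,\\[1em] |2c-a-b|+\sqrt{(2c-a-b)^2+(b-a)^2} & \text{if } c\ge c_0.\end{cases}$$ In particular, $\mathcal{M}^*(a,b,c_0)=a+b$.
   Context: $C^{1,1}([0,1])$ denotes the space of differentiable functions on $[0,1]$ with Lipschitz derivative (equivalently $W^{2,\infty}([0,1])$); $G''$ is understood in the sense of distributions, so that $\|G''\|_{L^\infty([0,1])}$ is the best Lipschitz constant of $G'$. For real $a,b,c\ge 0$, $$\mathcal{M}^*(a,b,c):=\inf\left\{\|G''\|_{L^\infty([0,1])} : G\in C^{1,1}([0,1]),\ G(0)=0,\ G(1)=c,\ G'(0)=a,\ G'(1)=b,\ G'(x)\ge 0\ \forall x\in[0,1]\right\},$$ with the convention $\inf\varnothing=\infty$. *)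

theory Defs
  imports "HOL-Analysis.Analysis" "HOL-Probability.Essential_Supremum"
begin

text \<open>Functions on \<open>[0,1]\<close> are represented by total functions on the reals of which only the values
  on \<open>{0..1}\<close> are used; derivatives at the endpoints are one-sided.\<close>

definition deriv01 :: "(real \<Rightarrow> real) \<Rightarrow> real \<Rightarrow> real" where
  "deriv01 G x = vector_derivative G (at x within {0..1})"

definition C11 :: "(real \<Rightarrow> real) set" where
  "C11 = {G. G differentiable_on {0..1} \<and> (\<exists>L. L-lipschitz_on {0..1} (deriv01 G))}"

text \<open>\<open>C\<^sub>c\<^sup>\<infinity>((0,1))\<close>, extended by zero to the real line.\<close>

definition test_functions :: "(real \<Rightarrow> real) set" where
  "test_functions = {\<phi>. (\<forall>n. (deriv ^^ n) \<phi> differentiable_on UNIV) \<and>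
                        closure {x. \<phi> x \<noteq> 0} \<subseteq> {0<..<1}}"

text \<open>The distribution \<open>G''\<close> on \<open>(0,1)\<close> is represented by the locally integrable function \<open>g\<close>.\<close>

definition distr_second_deriv :: "(real \<Rightarrow> real) \<Rightarrow> (real \<Rightarrow> real) \<Rightarrow> bool" where
  "distr_second_deriv G g \<longleftrightarrow>
     (\<forall>K. compact K \<and> K \<subseteq> {0<..<1} \<longrightarrow> g absolutely_integrable_on K) \<and>
     (\<forall>\<phi>\<in>test_functions.
        (LINT x:{0..1}|lebesgue. G x * deriv (deriv \<phi>) x) = (LINT x:{0..1}|lebesgue. g x * \<phi> x))"

definition Linf_norm :: "(real \<Rightarrow> real) \<Rightarrow> ereal" where
  "Linf_norm g = esssup (lebesgue_on {0..1}) (\<lambda>x. ereal \<bar>g x\<bar>)"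

text \<open>The norm of \<open>G''\<close> in \<open>L\<^sup>\<infinity>([0,1])\<close>. The representing function is unique up to null sets, so the
  infimum only serves to select its norm, and is \<open>\<infinity>\<close> if \<open>G''\<close> is not a function.\<close>

definition Linf_norm_second_deriv :: "(real \<Rightarrow> real) \<Rightarrow> ereal" where
  "Linf_norm_second_deriv G = Inf {Linf_norm g | g. distr_second_deriv G g}"

definition M_star :: "real \<Rightarrow> real \<Rightarrow> real \<Rightarrow> ereal" where
  "M_star a b c = Inf {Linf_norm_second_deriv G | G. G \<in> C11 \<and> G 0 = 0 \<and> G 1 = c \<and>
     deriv01 G 0 = a \<and> deriv01 G 1 = b \<and> (\<forall>x\<in>{0..1}. deriv01 G x \<ge> 0)}"

text \<open>For \<open>a, b \<ge> 0\<close> the denominator vanishes only if the numerator does, so real division, with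
  \<open>0 / 0 = 0\<close>, suffices here.\<close>

definition c_zero :: "real \<Rightarrow> real \<Rightarrow> real" where
  "c_zero a b = (a\<^sup>2 + b\<^sup>2) / (2 * (a + b))"

text \<open>Division of extended reals follows the conventions \<open>0 / 0 = 0\<close> and \<open>\<epsilon> / 0 = \<infinity>\<close> for \<open>\<epsilon> > 0\<close>.\<close>

lemma ereal_divide_zero_conventions:
  "(0::ereal) / 0 = 0"
  "0 < \<epsilon> \<Longrightarrow> ereal \<epsilon> / 0 = \<infinity>"
  by (simp_all add: divide_ereal_def)

end

theory Submission
  imports Defs
begin

text \<open>
  Testing \<open>G''\<close> against smooth approximations of indicators of \<open>[x,y]\<close> shows that
  \<open>\<bar>G''\<bar> \<le> M\<close> almost everywhere forces \<open>G'\<close> to be \<open>M\<close>-Lipschitz, hence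
  \<open>G'(x) \<ge> max (a - M x) (b - M (1 - x))\<close>. Integrating this up to and beyond the point where
  the two lines cross, and doing the same for \<open>-G\<close>, yields \<open>M\<^sup>2 - 2 M \<bar>d\<bar> \<ge> (b - a)\<^sup>2\<close> with
  \<open>d = 2 c - a - b\<close>, which is the second formula as a lower bound for every \<open>c\<close>. If \<open>c \<le> c\<^sub>0\<close> this
  bound is at least \<open>a + b\<close>, so the two lines reach zero before they meet, and
  \<open>G' \<ge> 0\<close> in between improves the estimate to \<open>2 c M \<ge> a\<^sup>2 + b\<^sup>2\<close>. Both bounds are attained by
  piecewise linear \<open>G'\<close> with slopes \<open>k, 0, -k\<close>, where \<open>\<bar>k\<bar> = M\<close>.
\<close>

section \<open>Smooth steps built from \<open>exp (- 1 / w)\<close>\<close>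

text \<open>For fixed \<open>W\<close> this family is closed under differentiation, so one
  derivative formula settles all orders at once. A quadratic \<open>W\<close> that is positive
  between two zeros gives the usual bump function.\<close>

definition flat_fun :: "real poly \<Rightarrow> real poly \<Rightarrow> nat \<Rightarrow> real \<Rightarrow> real" where
  "flat_fun W R n t =
     (if poly W t > 0 then poly R t / poly W t ^ n * exp (- 1 / poly W t) else 0)"

lemma power_div_fact_le_exp:
  fixes x :: real
  assumes "x \<ge> 0"
  shows "x ^ n / fact n \<le> exp x"
proof -
  have "(\<Sum>k\<in>{n}. x ^ k /\<^sub>R fact k) \<le> (\<Sum>k. x ^ k /\<^sub>R fact k)"
    using assms summable_exp_generic[of x] by (intro sum_le_suminf) auto
  then show ?thesis
    by (simp add: exp_def divide_inverse mult.commute)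
qed

text \<open>The square makes all derivatives of \<open>flat_fun W R n\<close> vanish at the zeros of \<open>W\<close>.\<close>

lemma abs_flat_fun_le: "\<bar>flat_fun W R n t\<bar> \<le> \<bar>fact (n + 2) * poly R t * (poly W t)\<^sup>2\<bar>"
proof (cases "poly W t > 0")
  case True
  define w where "w = poly W t"
  have w: "w > 0"
    using True by (simp add: w_def)
  have "(1 / w) ^ (n + 2) / fact (n + 2) \<le> exp (1 / w)"
    by (rule power_div_fact_le_exp) (use w in simp)
  then have "1 / (w ^ (n + 2) * fact (n + 2)) \<le> exp (1 / w)"
    by (simp add: power_divide)
  then have "1 \<le> exp (1 / w) * (w ^ (n + 2) * fact (n + 2))"
    by (subst (asm) divide_le_eq) (use w in simp)
  then have "exp (- 1 / w) \<le> w ^ (n + 2) * fact (n + 2)"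
    using w by (simp add: exp_minus inverse_eq_divide divide_le_eq mult.commute del: power_Suc fact_Suc add_2_eq_Suc')
  then have "exp (- 1 / w) / w ^ n \<le> w\<^sup>2 * fact (n + 2)"
    using w by (simp add: divide_le_eq power_add mult_ac del: power_Suc fact_Suc add_2_eq_Suc')
  then have "\<bar>poly R t\<bar> * (exp (- 1 / w) / w ^ n) \<le> \<bar>poly R t\<bar> * (w\<^sup>2 * fact (n + 2))"
    by (intro mult_left_mono) auto
  then show ?thesis
    using w by (simp add: flat_fun_def w_def abs_mult mult_ac del: fact_Suc add_2_eq_Suc')
qed (simp add: flat_fun_def)

text \<open>Both functions vanish at \<open>t\<close>, so the difference quotient of
  \<open>f\<close> is dominated by that of \<open>g\<close>. This handles the points where a
  piecewise formula changes.\<close>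

lemma has_field_derivative_zero_dominated:
  fixes f g :: "real \<Rightarrow> real"
  assumes g: "(g has_field_derivative 0) (at t)" "g t = 0" and le: "\<And>s. \<bar>f s\<bar> \<le> \<bar>g s\<bar>"
  shows "(f has_field_derivative 0) (at t)"
proof -
  have "f t = 0"
    using le[of t] g(2) by simp
  have "((\<lambda>s. (g s - g t) / (s - t)) \<longlongrightarrow> 0) (at t)"
    using g(1) by (simp add: has_field_derivative_iff)
  then have "((\<lambda>s. (f s - f t) / (s - t)) \<longlongrightarrow> 0) (at t)"
    by (rule Lim_null_comparison[rotated, OF tendsto_rabs_zero])
      (use le \<open>f t = 0\<close> g(2) in \<open>auto intro!: always_eventually divide_right_mono simp: abs_divide\<close>)
  then show ?thesis
    by (simp add: has_field_derivative_iff)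
qed

text \<open>The inner derivative of \<open>exp (- 1 / W)\<close> contributes
  \<open>W' / W\<^sup>2\<close>; all three terms of the derivative are then brought over the common
  denominator \<open>W ^ (n + 2)\<close>.\<close>

lemma DERIV_flat_fun:
  "(flat_fun W R n has_field_derivative
     flat_fun W (pderiv R * W\<^sup>2 - of_nat n * R * pderiv W * W + R * pderiv W) (n + 2) t) (at t)"
    (is "(_ has_field_derivative flat_fun W ?R' _ t) _")
proof -
  have cont: "isCont (poly W) t"
    by simp
  consider "poly W t > 0" | "poly W t < 0" | "poly W t = 0" by linarith
  then show ?thesis
  proof cases
    case 1
    define w where "w = poly W t"
    have w: "w > 0"
      using 1 by (simp add: w_def)
    \<comment> \<open>The sign of \<open>W\<close> persists near \<open>t\<close>, so
      \<open>flat_fun\<close> may be replaced there by a single formula.\<close>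
    have ev: "\<forall>\<^sub>F s in nhds t. poly W s > 0"
      using order_tendstoD(1)[OF isContD[OF cont] 1] 1 by (simp add: eventually_nhds_conv_at)
    have "((\<lambda>s. poly R s / poly W s ^ n * exp (- 1 / poly W s)) has_field_derivative
        ((poly (pderiv R) t * w ^ n - poly R t * (of_nat n * (poly (pderiv W) t * w ^ (n - 1)))) / (w ^ n * w ^ n)
          * exp (- 1 / w) + poly R t / w ^ n * (exp (- 1 / w) * (poly (pderiv W) t / (w * w))))) (at t)"
      using w unfolding w_def by (auto intro!: derivative_eq_intros simp: field_simps)
    also have "((poly (pderiv R) t * w ^ n - poly R t * (of_nat n * (poly (pderiv W) t * w ^ (n - 1)))) / (w ^ n * w ^ n)
          * exp (- 1 / w) + poly R t / w ^ n * (exp (- 1 / w) * (poly (pderiv W) t / (w * w)))) =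
        flat_fun W ?R' (n + 2) t"
      using w by (cases n) (simp_all add: flat_fun_def w_def[symmetric] field_simps power2_eq_square)
    finally show ?thesis
      by (rule DERIV_cong_ev[THEN iffD1, rotated -1])
        (use ev in \<open>auto simp: flat_fun_def elim!: eventually_mono\<close>)
  next
    case 2
    have ev: "\<forall>\<^sub>F s in nhds t. poly W s < 0"
      using order_tendstoD(2)[OF isContD[OF cont] 2] 2 by (simp add: eventually_nhds_conv_at)
    have "((\<lambda>s. 0) has_field_derivative flat_fun W ?R' (n + 2) t) (at t)"
      using 2 by (simp add: flat_fun_def)
    then show ?thesis
      by (rule DERIV_cong_ev[THEN iffD1, rotated -1])
        (use ev in \<open>auto simp: flat_fun_def elim!: eventually_mono\<close>)
  next
    case 3
    \<comment> \<open>Because of the square, every term of this derivative carries a factor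
      \<open>poly W t\<close>, which is zero here.\<close>
    have "((\<lambda>s. fact (n + 2) * poly R s * (poly W s)\<^sup>2) has_field_derivative 0) (at t)"
      using 3 by (auto intro!: derivative_eq_intros)
    then have "(flat_fun W R n has_field_derivative 0) (at t)"
      by (rule has_field_derivative_zero_dominated) (simp_all only: 3 abs_flat_fun_le, simp)
    then show ?thesis
      using 3 by (simp add: flat_fun_def)
  qed
qed

text \<open>The first condition of \<open>test_functions\<close>, separated from the support
  condition so that it also applies to steps.\<close>

definition smooth :: "(real \<Rightarrow> real) \<Rightarrow> bool" where
  "smooth f \<longleftrightarrow> (\<forall>n. (deriv ^^ n) f differentiable_on UNIV)"

lemma smooth_flat_fun: "smooth (flat_fun W R n)"
proof -
  have "\<exists>R' n'. (deriv ^^ k) (flat_fun W R n) = flat_fun W R' n'" for k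
  proof (induction k)
    case (Suc k)
    then obtain R' n' where eq: "(deriv ^^ k) (flat_fun W R n) = flat_fun W R' n'"
      by blast
    have "deriv (flat_fun W R' n') =
        flat_fun W (pderiv R' * W\<^sup>2 - of_nat n' * R' * pderiv W * W + R' * pderiv W) (n' + 2)"
      by (intro ext DERIV_imp_deriv DERIV_flat_fun)
    then show ?case
      using eq by (metis comp_apply funpow.simps(2))
  qed auto
  then show ?thesis
    unfolding smooth_def differentiable_on_def
    by (metis DERIV_flat_fun field_differentiable_def field_differentiable_imp_differentiable)
qed

lemma smooth_antiderivative:
  assumes "smooth f" and "\<And>t. (F has_field_derivative f t) (at t)"
  shows "smooth F"
proof -
  have "deriv F = f"
    using DERIV_imp_deriv[OF assms(2)] by auto
  have "(deriv ^^ n) F differentiable_on UNIV" for n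
  proof (cases n)
    case 0
    have "F differentiable at t" for t
      using assms(2) by (meson field_differentiable_def field_differentiable_imp_differentiable)
    then show ?thesis
      using 0 by (simp add: differentiable_on_def)
  next
    case (Suc k)
    then have "(deriv ^^ n) F = (deriv ^^ k) f"
      using \<open>deriv F = f\<close> by (simp add: funpow_swap1)
    then show ?thesis
      using assms(1) by (simp add: smooth_def)
  qed
  then show ?thesis
    by (simp add: smooth_def)
qed

lemma smooth_imp_deriv:
  assumes "smooth f"
  shows "((deriv ^^ n) f has_field_derivative (deriv ^^ Suc n) f t) (at t)"
  using assms
  by (auto simp: smooth_def differentiable_on_def DERIV_deriv_iff_real_differentiable)

lemma smooth_linear_combination:
  assumes "smooth f" "smooth g"
  shows "smooth (\<lambda>t. c * f t + d * g t)"
proof -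
  have eq: "(deriv ^^ n) (\<lambda>t. c * f t + d * g t) = (\<lambda>t. c * (deriv ^^ n) f t + d * (deriv ^^ n) g t)" for n
  proof (induction n)
    case (Suc n)
    have "((\<lambda>t. c * (deriv ^^ n) f t + d * (deriv ^^ n) g t) has_field_derivative
       (c * (deriv ^^ Suc n) f t + d * (deriv ^^ Suc n) g t)) (at t)" for t
      by (intro DERIV_add DERIV_cmult smooth_imp_deriv assms)
    from DERIV_imp_deriv[OF this] show ?case
      by (simp add: Suc.IH fun_eq_iff)
  qed auto
  show ?thesis
    unfolding smooth_def eq using assms
    by (auto simp: smooth_def intro!: derivative_intros)
qed

text \<open>\<open>S\<close> is the normalized antiderivative of a bump on \<open>{u..v}\<close>.
  The difference of two such steps will approximate an indicator, and \<open>s\<close> will act as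
  an approximate point mass.\<close>

lemma smooth_step_exists:
  fixes u v :: real
  assumes "u < v"
  obtains S s where "smooth S" "\<And>t. (S has_field_derivative s t) (at t)"
    "\<And>t. s t \<ge> 0" "\<And>t. t \<notin> {u..v} \<Longrightarrow> s t = 0"
    "\<And>t. t \<le> u \<Longrightarrow> S t = 0" "\<And>t. t \<ge> v \<Longrightarrow> S t = 1" "\<And>t. 0 \<le> S t" "\<And>t. S t \<le> 1"
proof -
  \<comment> \<open>The expanded product \<open>(t - u) * (v - t)\<close>, positive exactly between
    \<open>u\<close> and \<open>v\<close>.\<close>
  define W where "W = [:- u * v, u + v, - 1:]"
  have W: "poly W t = (t - u) * (v - t)" for t
    by (simp add: W_def algebra_simps)
  define b where "b = flat_fun W 1 0"
  have b: "b t = (if t \<in> {u<..<v} then exp (- 1 / ((t - u) * (v - t))) else 0)" for t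
    using assms by (auto simp: b_def flat_fun_def W zero_less_mult_iff)
  have "smooth b"
    unfolding b_def by (rule smooth_flat_fun)
  have cont: "isCont b t" for t
    unfolding b_def using DERIV_flat_fun DERIV_isCont by blast
  obtain F where "\<forall>t::real. -\<infinity> < ereal t \<longrightarrow> ereal t < \<infinity> \<longrightarrow> (F has_vector_derivative b t) (at t)"
    using einterval_antiderivative[of "-\<infinity>" \<infinity> b] cont by auto
  then have F: "(F has_field_derivative b t) (at t)" for t
    by (simp add: has_real_derivative_iff_has_vector_derivative)
  have mono: "F x \<le> F y" if "x \<le> y" for x y
    using that by (rule DERIV_nonneg_imp_nondecreasing) (use F b in \<open>metis exp_ge_zero order_refl\<close>)
  have const: "F y = F x" if "x \<le> y" "\<And>t. x < t \<Longrightarrow> t < y \<Longrightarrow> b t = 0" for x y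
  proof (cases "x = y")
    case False
    have "(F has_field_derivative 0) (at t)" if "x < t" "t < y" for t
      using F[of t] \<open>\<And>t. x < t \<Longrightarrow> t < y \<Longrightarrow> b t = 0\<close> that by simp
    moreover have "continuous_on {x..y} F"
      by (rule DERIV_continuous_on[OF DERIV_subset[OF F]]) auto
    ultimately show ?thesis
      using that(1) False by (intro DERIV_isconst_end) auto
  qed auto
  have left: "F t = F u" if "t \<le> u" for t
    using const[of t u] that by (simp add: b)
  have right: "F t = F v" if "t \<ge> v" for t
    using const[of v t] that by (simp add: b)
  have "\<exists>d. (F has_field_derivative d) (at t) \<and> 0 < d" if "u < t" "t < v" for t
    using F[of t] that b[of t] by (metis exp_gt_zero greaterThanLessThan_iff)
  then have "F u < F v"
    by (intro DERIV_pos_imp_increasing_open[OF assms])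
       (auto intro!: DERIV_continuous_on[OF DERIV_subset[OF F]])
  \<comment> \<open>Rescaling by the positive total increase of \<open>F\<close> makes the step rise
    from 0 to 1.\<close>
  define c where "c = 1 / (F v - F u)"
  have c: "c > 0" "c * (F v - F u) = 1"
    using \<open>F u < F v\<close> by (auto simp: c_def)
  define S where "S t = c * (F t - F u)" for t
  have S': "(S has_field_derivative c * b t) (at t)" for t
    unfolding S_def by (auto intro!: derivative_eq_intros F)
  have "smooth (\<lambda>t. c * b t)"
    using smooth_linear_combination[OF \<open>smooth b\<close> \<open>smooth b\<close>, of c 0] by simp
  show ?thesis
  proof (rule that[of S "\<lambda>t. c * b t"])
    show "smooth S"
      by (rule smooth_antiderivative[OF \<open>smooth (\<lambda>t. c * b t)\<close> S'])
    show "S t = 0" if "t \<le> u" for t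
      using left[OF that] by (simp add: S_def)
    show "S t = 1" if "t \<ge> v" for t
      using right[OF that] c(2) by (simp add: S_def)
    have bounds: "F u \<le> F t" "F t \<le> F v" for t
      using mono[of u t] mono[of t v] left[of t] right[of t] \<open>F u < F v\<close> by fastforce+
    show "0 \<le> S t" for t
      using bounds c(1) by (simp add: S_def)
    have "c * (F t - F u) \<le> c * (F v - F u)" for t
      using bounds c(1) by (intro mult_left_mono) auto
    then show "S t \<le> 1" for t
      using c(2) by (simp add: S_def)
  qed (use S' c in \<open>auto simp: b\<close>)
qed

section \<open>One-sided derivatives, test functions and integration by parts\<close>

lemma C11_DERIV:
  assumes "G \<in> C11" "x \<in> {0..1}"
  shows "(G has_field_derivative deriv01 G x) (at x within {0..1})"
  using assms
  by (simp add: C11_def differentiable_on_def deriv01_def vector_derivative_works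
      has_real_derivative_iff_has_vector_derivative)

lemma deriv01_eqI:
  assumes "(G has_field_derivative d) (at x within {0..1})" "x \<in> {0..1}"
  shows "deriv01 G x = d"
  unfolding deriv01_def using assms
  by (intro vector_derivative_within_cbox[of 0 1, simplified])
     (simp_all add: has_real_derivative_iff_has_vector_derivative)

lemma test_function_DERIV:
  assumes "\<phi> \<in> test_functions"
  shows "(\<phi> has_field_derivative deriv \<phi> t) (at t)"
    and "(deriv \<phi> has_field_derivative deriv (deriv \<phi>) t) (at t)"
    and "(deriv (deriv \<phi>) has_field_derivative deriv (deriv (deriv \<phi>)) t) (at t)"
proof -
  have "smooth \<phi>"
    using assms by (simp add: test_functions_def smooth_def)
  from smooth_imp_deriv[OF this, of 0 t] smooth_imp_deriv[OF this, of "Suc 0" t]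
    smooth_imp_deriv[OF this, of "Suc (Suc 0)" t]
  show "(\<phi> has_field_derivative deriv \<phi> t) (at t)"
    and "(deriv \<phi> has_field_derivative deriv (deriv \<phi>) t) (at t)"
    and "(deriv (deriv \<phi>) has_field_derivative deriv (deriv (deriv \<phi>)) t) (at t)"
    by simp_all
qed

text \<open>The complement of the closed support is open, so \<phi> vanishes in a whole
  neighbourhood of \<open>t\<close>. At 0 and 1 this removes the boundary terms of integrations by
  parts.\<close>

lemma test_function_outside:
  assumes "\<phi> \<in> test_functions" "t \<notin> {0<..<1}"
  shows "\<phi> t = 0" "deriv \<phi> t = 0"
proof -
  have t: "t \<in> - closure {x. \<phi> x \<noteq> 0}"
    using assms by (auto simp: test_functions_def)
  have zero: "\<phi> s = 0" if "s \<in> - closure {x. \<phi> x \<noteq> 0}" for s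
  proof -
    have "s \<notin> {x. \<phi> x \<noteq> 0}"
      using that closure_subset[of "{x. \<phi> x \<noteq> 0}"] by blast
    then show ?thesis
      by simp
  qed
  from zero[OF t] show "\<phi> t = 0" .
  have "((\<lambda>s. 0) has_field_derivative deriv \<phi> t) (at t)"
    by (rule has_field_derivative_transform_within_open[OF test_function_DERIV(1)[OF assms(1)] _ t])
      (simp_all only: open_Compl closed_closure zero)
  then show "deriv \<phi> t = 0"
    using DERIV_unique DERIV_const by blast
qed

lemma continuous_on_DERIV:
  fixes f :: "real \<Rightarrow> real"
  assumes "\<And>t. (f has_field_derivative f' t) (at t)"
  shows "continuous_on A f"
  using assms by (meson DERIV_isCont continuous_at_imp_continuous_on)

lemma set_lebesgue_integral_continuous_real:
  fixes f :: "real \<Rightarrow> real"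
  assumes "continuous_on {a..b} f"
  shows "(LINT x:{a..b}|lebesgue. f x) = integral {a..b} f"
  by (rule set_lebesgue_integral_eq_integral(2)[OF absolutely_integrable_continuous_real[OF assms]])

text \<open>Two integrations by parts in one: \<open>G * \<phi>' - h * \<phi>\<close> is an
  antiderivative of \<open>G * \<phi>'' - g * \<phi>\<close> and vanishes at both endpoints. At the
  finitely many points of \<open>N\<close> its continuity suffices.\<close>

lemma distr_second_derivI:
  fixes G h g :: "real \<Rightarrow> real"
  assumes G: "\<And>x. (G has_field_derivative h x) (at x)"
    and h: "\<And>x. x \<notin> N \<Longrightarrow> (h has_field_derivative g x) (at x)"
    and "finite N" and conth: "continuous_on UNIV h"
    and g: "g \<in> borel_measurable borel" "\<And>x. \<bar>g x\<bar> \<le> B"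
  shows "distr_second_deriv G g"
  unfolding distr_second_deriv_def
proof (intro conjI allI impI ballI)
  fix K :: "real set"
  assume K: "compact K \<and> K \<subseteq> {0<..<1}"
  have "set_integrable lborel K (\<lambda>x. B)"
    using K borel_integrable_compact[of K "\<lambda>x. B"] by (simp add: set_integrable_def indicator_scaleR_eq_if)
  then have "set_integrable lborel K g"
    by (rule set_integrable_bound)
       (use K g in \<open>auto simp: set_borel_measurable_def compact_imp_closed borel_closed
          intro!: AE_I2 intro: order_trans[OF g(2) abs_ge_self]\<close>)
  then show "g absolutely_integrable_on K"
    using K g(1) by (simp add: set_integrable_def integrable_completion compact_imp_closed borel_closed)
next
  fix \<phi> :: "real \<Rightarrow> real"
  assume \<phi>: "\<phi> \<in> test_functions"
  note D = test_function_DERIV[OF \<phi>]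
  note out = test_function_outside[OF \<phi>]
  have c: "continuous_on A G" "continuous_on A \<phi>" "continuous_on A (deriv \<phi>)"
     "continuous_on A (deriv (deriv \<phi>))" "continuous_on A h" for A
    using continuous_on_DERIV[OF D(1)] continuous_on_DERIV[OF D(2)] continuous_on_DERIV[OF D(3)]
      continuous_on_DERIV[OF G] continuous_on_subset[OF conth] by auto
  have "((\<lambda>x. G x * deriv (deriv \<phi>) x - g x * \<phi> x) has_integral
      ((G 1 * deriv \<phi> 1 - h 1 * \<phi> 1) - (G 0 * deriv \<phi> 0 - h 0 * \<phi> 0))) {0..1}"
  proof (rule fundamental_theorem_of_calculus_interior_strong[OF \<open>finite N\<close>])
    fix x :: real
    assume "x \<in> {0<..<1} - N"
    then have "((\<lambda>x. G x * deriv \<phi> x - h x * \<phi> x) has_field_derivative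
        (h x * deriv \<phi> x + G x * deriv (deriv \<phi>) x) - (g x * \<phi> x + h x * deriv \<phi> x)) (at x)"
      by (auto intro!: derivative_eq_intros G h D)
    then show "((\<lambda>x. G x * deriv \<phi> x - h x * \<phi> x) has_vector_derivative
        G x * deriv (deriv \<phi>) x - g x * \<phi> x) (at x)"
      by (simp add: has_real_derivative_iff_has_vector_derivative algebra_simps)
  qed (auto intro!: continuous_intros c)
  then have diff: "((\<lambda>x. G x * deriv (deriv \<phi>) x - g x * \<phi> x) has_integral 0) {0..1}"
    by (simp add: out)
  have 1: "set_integrable lebesgue {0..1} (\<lambda>x. G x * deriv (deriv \<phi>) x)"
    by (intro absolutely_integrable_continuous_real continuous_intros c)
  have 2: "set_integrable lebesgue {0..1} (\<lambda>x. g x * \<phi> x)"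
  proof (rule absolutely_integrable_bounded_measurable_product_real)
    show "g \<in> borel_measurable (lebesgue_on {0..1})"
      using g(1) by (simp add: measurable_restrict_space1 measurable_completion)
    show "bounded (g ` {0..1})"
      using g(2) by (auto simp: bounded_iff)
    show "\<phi> absolutely_integrable_on {0..1}"
      by (intro absolutely_integrable_continuous_real c)
  qed auto
  note E1 = set_lebesgue_integral_eq_integral[OF 1]
  note E2 = set_lebesgue_integral_eq_integral[OF 2]
  have "integral {0..1} (\<lambda>x. G x * deriv (deriv \<phi>) x) - integral {0..1} (\<lambda>x. g x * \<phi> x) = 0"
    using integral_unique[OF diff] E1(1) E2(1) by (simp add: integral_diff)
  then show "(LINT x:{0..1}|lebesgue. G x * deriv (deriv \<phi>) x) = (LINT x:{0..1}|lebesgue. g x * \<phi> x)"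
    using E1(2) E2(2) by simp
qed

section \<open>Essential bounds on \<open>G''\<close> and the Lipschitz constant of
  \<open>G'\<close>\<close>

lemma Linf_norm_le:
  assumes "g \<in> borel_measurable borel" "\<And>x. \<bar>g x\<bar> \<le> B"
  shows "Linf_norm g \<le> ereal B"
  unfolding Linf_norm_def
proof (rule esssup_I)
  \<comment> \<open>The \<open>esssup\<close> of a non-measurable function is
    \<open>\<infinity>\<close>, so measurability has to be supplied.\<close>
  have "g \<in> borel_measurable (lebesgue_on {0..1})"
    using assms(1) by (simp add: measurable_restrict_space1 measurable_completion)
  then show "(\<lambda>x. ereal \<bar>g x\<bar>) \<in> borel_measurable (lebesgue_on {0..1})"
    by measurable
qed (use assms in auto)

lemma AE_le_of_Linf_norm_le:
  assumes "Linf_norm g \<le> ereal M"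
  shows "AE x in lebesgue. x \<in> {0..1} \<longrightarrow> \<bar>g x\<bar> \<le> M" and "0 \<le> M"
proof -
  have "AE x in lebesgue_on {0..1}. ereal \<bar>g x\<bar> \<le> ereal M"
    using esssup_AE[of "\<lambda>x. ereal \<bar>g x\<bar>" "lebesgue_on {0..1}"]
    by eventually_elim (use assms order_trans in \<open>unfold Linf_norm_def, blast\<close>)
  then have AE: "AE x in lebesgue_on {0..1}. \<bar>g x\<bar> \<le> M"
    by simp
  then show "AE x in lebesgue. x \<in> {0..1} \<longrightarrow> \<bar>g x\<bar> \<le> M"
    by (simp add: AE_restrict_space_iff)
  show "0 \<le> M"
  proof (rule ccontr)
    assume "\<not> 0 \<le> M"
    \<comment> \<open>A negative bound on \<open>\<bar>g x\<bar>\<close> fails everywhere, whereas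
      \<open>{0..1}\<close> has positive measure.\<close>
    with AE have "AE x in lebesgue_on {0..1::real}. False"
      by (auto elim!: eventually_mono)
    then have "ae_filter (lebesgue_on {0..1::real}) = bot"
      by (simp add: trivial_limit_def)
    then have "emeasure (lebesgue_on {0..1::real}) (space (lebesgue_on {0..1})) = 0"
      by (simp only: ae_filter_eq_bot_iff)
    then show False
      by (simp add: emeasure_restrict_space space_restrict_space)
  qed
qed

text \<open>Finiteness of \<open>Linf_norm g\<close> only makes \<open>\<bar>g\<bar>\<close> measurable, so integrability of \<open>g\<close> is needed.\<close>

lemma abs_set_lebesgue_integral_le:
  fixes g \<phi> :: "real \<Rightarrow> real"
  assumes g: "Linf_norm g \<le> ereal M" "g absolutely_integrable_on {x..y}"
    and xy: "0 < x" "x \<le> y" "y < 1"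
    and \<phi>: "continuous_on UNIV \<phi>" "\<And>t. \<phi> t \<ge> 0" "\<And>t. \<phi> t \<le> 1" "\<And>t. t \<notin> {x..y} \<Longrightarrow> \<phi> t = 0"
  shows "\<bar>LINT t:{0..1}|lebesgue. g t * \<phi> t\<bar> \<le> M * (y - x)"
proof -
  note M = AE_le_of_Linf_norm_le[OF g(1)]
  have i: "set_integrable lebesgue {x..y} (\<lambda>t. \<phi> t * g t)"
  proof (rule absolutely_integrable_bounded_measurable_product_real)
    show "\<phi> \<in> borel_measurable (lebesgue_on {x..y})"
      using \<phi>(1) by (intro continuous_imp_measurable_on_sets_lebesgue continuous_on_subset[OF \<phi>(1)]) auto
    show "bounded (\<phi> ` {x..y})"
      using \<phi>(2,3) by (auto simp: bounded_iff intro!: exI[of _ 1])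
  qed (use g in auto)
  have iM: "set_integrable lebesgue {x..y} (\<lambda>t. M)"
    by (intro absolutely_integrable_continuous_real continuous_intros)
  \<comment> \<open>The integral is cut down to \<open>{x..y}\<close>, where \<open>g\<close> is
    known to be integrable.\<close>
  have "(LINT t:{0..1}|lebesgue. g t * \<phi> t) = (LINT t:{x..y}|lebesgue. \<phi> t * g t)"
    unfolding set_lebesgue_integral_def
    by (intro Bochner_Integration.integral_cong) (use xy \<phi>(4) in \<open>auto simp: indicator_def\<close>)
  also have "\<bar>\<dots>\<bar> \<le> (LINT t:{x..y}|lebesgue. \<bar>\<phi> t * g t\<bar>)"
    using set_integral_norm_bound[OF i] by simp
  also have "\<dots> \<le> (LINT t:{x..y}|lebesgue. M)"
    unfolding set_lebesgue_integral_def
  proof (rule integral_mono_AE)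
    show "integrable lebesgue (\<lambda>t. indicat_real {x..y} t *\<^sub>R \<bar>\<phi> t * g t\<bar>)"
      using set_integrable_abs[OF i] by (simp add: set_integrable_def)
    show "integrable lebesgue (\<lambda>t. indicat_real {x..y} t *\<^sub>R M)"
      using iM by (simp add: set_integrable_def)
    show "AE t in lebesgue. indicat_real {x..y} t *\<^sub>R \<bar>\<phi> t * g t\<bar> \<le> indicat_real {x..y} t *\<^sub>R M"
      using M(1)
    proof eventually_elim
      case (elim t)
      have "\<phi> t * \<bar>g t\<bar> \<le> 1 * M" if "t \<in> {x..y}"
        using elim that xy \<phi>(2,3) by (intro mult_mono) auto
      then show ?case
        using \<phi>(2) by (auto simp: indicator_def abs_mult)
    qed
  qed
  also have "\<dots> = integral {x..y} (\<lambda>t. M)"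
    by (intro set_lebesgue_integral_continuous_real continuous_intros)
  also have "\<dots> = M * (y - x)"
    using xy by simp
  finally show ?thesis .
qed

text \<open>Here \<open>s\<close> is a probability density vanishing outside \<open>{u..v}\<close>,
  so the integral averages values of \<open>h\<close> that are within \<open>e\<close> of
  \<open>h w\<close>.\<close>

lemma integral_step_density:
  fixes h S s :: "real \<Rightarrow> real"
  assumes h: "continuous_on {0..1} h" "\<And>t. t \<in> {u..v} \<Longrightarrow> \<bar>h t - h w\<bar> \<le> e"
    and uv: "0 < u" "u < v" "v < 1"
    and S: "\<And>t. (S has_field_derivative s t) (at t)" "S 0 = 0" "S 1 = 1"
    and s: "continuous_on UNIV s" "\<And>t. s t \<ge> 0" "\<And>t. t \<notin> {u..v} \<Longrightarrow> s t = 0"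
  shows "\<bar>integral {0..1} (\<lambda>t. h t * s t) - h w\<bar> \<le> e"
proof -
  have s_int: "(s has_integral 1) {0..1}"
    using fundamental_theorem_of_calculus[of 0 1 S s] S
    by (auto simp: has_real_derivative_iff_has_vector_derivative[symmetric] intro: DERIV_subset)
  have i: "(\<lambda>t. h t * s t) integrable_on {0..1}"
    by (intro integrable_continuous_interval continuous_intros h continuous_on_subset[OF s(1)]) auto
  have "((\<lambda>t. h t * s t - h w * s t) has_integral (integral {0..1} (\<lambda>t. h t * s t) - h w * 1)) {0..1}"
    by (intro has_integral_diff has_integral_mult_right s_int integrable_integral i)
  moreover have "((\<lambda>t. e * s t) has_integral e * 1) {0..1}"
    by (intro has_integral_mult_right s_int)
  moreover have "\<bar>h t * s t - h w * s t\<bar> \<le> e * s t" for t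
    using h(2)[of t] s(2,3)[of t]
    by (cases "t \<in> {u..v}") (auto simp: left_diff_distrib[symmetric] abs_mult mult_right_mono)
  ultimately show ?thesis
    using integral_norm_bound_integral[of "\<lambda>t. h t * s t - h w * s t" "{0..1}" "\<lambda>t. e * s t"]
    by (auto simp: has_integral_iff)
qed

text \<open>\<open>G''\<close> is tested with a plateau \<phi> that rises on
  \<open>{x..x + \<delta>}\<close> and falls on \<open>{y - \<delta>..y}\<close>. Integration by
  parts turns the pairing into an average of \<open>G'\<close> near \<open>y\<close> minus one near
  \<open>x\<close>, while \<phi> being at most 1 bounds it by \<open>M * (y - x)\<close>.\<close>

lemma deriv01_lipschitz_interior:
  assumes G: "G \<in> C11" and g: "distr_second_deriv G g" "Linf_norm g \<le> ereal M"
    and xy: "0 < x" "x < y" "y < 1"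
  shows "\<bar>deriv01 G y - deriv01 G x\<bar> \<le> M * (y - x)"
proof -
  define h where "h = deriv01 G"
  obtain L where L: "L-lipschitz_on {0..1} h"
    using G by (auto simp: C11_def h_def)
  have "L \<ge> 0"
    using L by (rule lipschitz_on_nonneg)
  have conth: "continuous_on {0..1} h"
    using L by (rule lipschitz_on_continuous_on)
  have contG: "continuous_on {0..1} G"
    using C11_DERIV[OF G] by (rule DERIV_continuous_on)
  \<comment> \<open>The constant \<open>L\<close> that comes with \<open>C11\<close> enters only the
    averaging errors, which disappear as \<delta> tends to 0.\<close>
  have near: "\<bar>h s - h t\<bar> \<le> L * \<delta>" if "s \<in> {0..1}" "t \<in> {0..1}" "\<bar>s - t\<bar> \<le> \<delta>" for s t \<delta>
    using lipschitz_onD[OF L, of s t] that mult_left_mono[OF that(3) \<open>L \<ge> 0\<close>]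
    by (auto simp: dist_real_def)
  have approx: "\<bar>h y - h x\<bar> \<le> M * (y - x) + 2 * L * \<delta>" if "0 < \<delta>" "\<delta> < (y - x) / 2" for \<delta>
  proof -
    have "x < x + \<delta>" "y - \<delta> < y" "x + \<delta> \<le> y - \<delta>"
      using that by (auto simp: field_simps)
    obtain S s where S: "smooth S" "\<And>t. (S has_field_derivative s t) (at t)"
        "\<And>t. s t \<ge> 0" "\<And>t. t \<notin> {x..x + \<delta>} \<Longrightarrow> s t = 0"
        "\<And>t. t \<le> x \<Longrightarrow> S t = 0" "\<And>t. t \<ge> x + \<delta> \<Longrightarrow> S t = 1" "\<And>t. 0 \<le> S t" "\<And>t. S t \<le> 1"
      using smooth_step_exists[OF \<open>x < x + \<delta>\<close>] by metis
    obtain S' s' where S': "smooth S'" "\<And>t. (S' has_field_derivative s' t) (at t)"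
        "\<And>t. s' t \<ge> 0" "\<And>t. t \<notin> {y - \<delta>..y} \<Longrightarrow> s' t = 0"
        "\<And>t. t \<le> y - \<delta> \<Longrightarrow> S' t = 0" "\<And>t. t \<ge> y \<Longrightarrow> S' t = 1" "\<And>t. 0 \<le> S' t" "\<And>t. S' t \<le> 1"
      using smooth_step_exists[OF \<open>y - \<delta> < y\<close>] by metis
    define \<phi> where "\<phi> t = S t - S' t" for t
    have out: "\<phi> t = 0" if "t \<notin> {x..y}" for t
      using that S(5,6)[of t] S'(5,6)[of t] \<open>x + \<delta> \<le> y - \<delta>\<close> \<open>0 < \<delta>\<close>
      by (cases "t < x") (auto simp: \<phi>_def)
    have \<phi>01: "0 \<le> \<phi> t" "\<phi> t \<le> 1" for t
      using S(5-8)[of t] S'(5-8)[of t] \<open>x + \<delta> \<le> y - \<delta>\<close> \<open>0 < \<delta>\<close>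
      by (cases "t \<le> y - \<delta>"; force simp: \<phi>_def)+
    have "smooth \<phi>"
      using smooth_linear_combination[OF S(1) S'(1), of 1 "-1"] by (simp add: \<phi>_def[abs_def])
    moreover have "closure {t. \<phi> t \<noteq> 0} \<subseteq> {x..y}"
      by (rule closure_minimal) (use out in blast, simp)
    then have "closure {t. \<phi> t \<noteq> 0} \<subseteq> {0<..<1}"
      using xy by auto
    ultimately have test: "\<phi> \<in> test_functions"
      by (simp add: test_functions_def smooth_def)
    have \<phi>': "deriv \<phi> = (\<lambda>t. s t - s' t)"
      unfolding \<phi>_def[abs_def] by (intro ext DERIV_imp_deriv DERIV_diff S S')
    note D = test_function_DERIV[OF test] and zero = test_function_outside[OF test]
    have cont: "continuous_on A \<phi>" "continuous_on A (deriv \<phi>)" "continuous_on A (deriv (deriv \<phi>))" for A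
      by (rule continuous_on_DERIV, rule D)+
    have cont_s: "continuous_on A s" "continuous_on A s'" for A
    proof -
      have "deriv S = s" "deriv S' = s'"
        using DERIV_imp_deriv[OF S(2)] DERIV_imp_deriv[OF S'(2)] by auto
      then show "continuous_on A s" "continuous_on A s'"
        using continuous_on_DERIV[OF smooth_imp_deriv[OF S(1), of 1]]
          continuous_on_DERIV[OF smooth_imp_deriv[OF S'(1), of 1]] by auto
    qed
    have "((\<lambda>t. h t * deriv \<phi> t + G t * deriv (deriv \<phi>) t) has_integral
        (G 1 * deriv \<phi> 1 - G 0 * deriv \<phi> 0)) {0..1}"
    proof (rule fundamental_theorem_of_calculus)
      fix t :: real
      assume "t \<in> {0..1}"
      then have "((\<lambda>t. G t * deriv \<phi> t) has_field_derivative
          h t * deriv \<phi> t + G t * deriv (deriv \<phi>) t) (at t within {0..1})"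
        using C11_DERIV[OF G] by (auto intro!: derivative_eq_intros DERIV_subset[OF D(2)] simp: h_def)
      then show "((\<lambda>t. G t * deriv \<phi> t) has_vector_derivative
          h t * deriv \<phi> t + G t * deriv (deriv \<phi>) t) (at t within {0..1})"
        by (simp add: has_real_derivative_iff_has_vector_derivative)
    qed auto
    moreover have i: "(\<lambda>t. h t * deriv \<phi> t) integrable_on {0..1}"
        "(\<lambda>t. G t * deriv (deriv \<phi>) t) integrable_on {0..1}"
        "(\<lambda>t. h t * s t) integrable_on {0..1}" "(\<lambda>t. h t * s' t) integrable_on {0..1}"
      by (intro integrable_continuous_interval continuous_intros conth contG cont cont_s)+
    ultimately have parts: "integral {0..1} (\<lambda>t. G t * deriv (deriv \<phi>) t) = - integral {0..1} (\<lambda>t. h t * deriv \<phi> t)"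
      by (simp add: has_integral_iff integral_add zero)
    have "(LINT t:{0..1}|lebesgue. g t * \<phi> t) = (LINT t:{0..1}|lebesgue. G t * deriv (deriv \<phi>) t)"
      using g(1) test by (simp add: distr_second_deriv_def)
    also have "\<dots> = integral {0..1} (\<lambda>t. G t * deriv (deriv \<phi>) t)"
      by (intro set_lebesgue_integral_continuous_real continuous_intros contG cont)
    also have "\<dots> = integral {0..1} (\<lambda>t. h t * s' t) - integral {0..1} (\<lambda>t. h t * s t)"
    proof -
      have "integral {0..1} (\<lambda>t. h t * deriv \<phi> t) =
          integral {0..1} (\<lambda>t. h t * s t) - integral {0..1} (\<lambda>t. h t * s' t)"
        unfolding \<phi>' right_diff_distrib using i(3,4) by (rule integral_diff)
      then show ?thesis
        unfolding parts by simp
    qed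
    finally have eq: "(LINT t:{0..1}|lebesgue. g t * \<phi> t) =
        integral {0..1} (\<lambda>t. h t * s' t) - integral {0..1} (\<lambda>t. h t * s t)" .
    have gK: "g absolutely_integrable_on {x..y}"
    proof -
      have "compact {x..y}" "{x..y} \<subseteq> {0<..<1}"
        using xy by auto
      then show ?thesis
        using g(1) unfolding distr_second_deriv_def by blast
    qed
    have "\<bar>LINT t:{0..1}|lebesgue. g t * \<phi> t\<bar> \<le> M * (y - x)"
      by (rule abs_set_lebesgue_integral_le[OF g(2) gK]) (use xy \<phi>01 out cont in auto)
    moreover have "\<bar>integral {0..1} (\<lambda>t. h t * s t) - h x\<bar> \<le> L * \<delta>"
      by (rule integral_step_density[where u = x and v = "x + \<delta>" and S = S])
        (use S xy that cont_s conth \<open>x + \<delta> \<le> y - \<delta>\<close> in \<open>auto intro!: near\<close>)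
    moreover have "\<bar>integral {0..1} (\<lambda>t. h t * s' t) - h y\<bar> \<le> L * \<delta>"
      by (rule integral_step_density[where u = "y - \<delta>" and v = y and S = S'])
        (use S' xy that cont_s conth \<open>x + \<delta> \<le> y - \<delta>\<close> in \<open>auto intro!: near\<close>)
    ultimately show ?thesis
      unfolding eq by (auto simp: abs_le_iff)
  qed
  have "((\<lambda>\<delta>. M * (y - x) + 2 * L * \<delta>) \<longlongrightarrow> M * (y - x) + 2 * L * 0) (at_right 0)"
    by (intro tendsto_intros)
  moreover have "\<forall>\<^sub>F \<delta> in at_right 0. \<bar>h y - h x\<bar> \<le> M * (y - x) + 2 * L * \<delta>"
    using approx xy by (auto simp: eventually_at_right_field intro!: exI[of _ "(y - x) / 2"])
  ultimately show ?thesis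
    unfolding h_def[symmetric] by (auto dest!: tendsto_lowerbound)
qed

text \<open>Test functions reach interior points only; continuity of \<open>G'\<close> carries the
  estimate to the closed interval.\<close>

lemma deriv01_lipschitz:
  assumes G: "G \<in> C11" and g: "distr_second_deriv G g" "Linf_norm g \<le> ereal M"
  shows "M-lipschitz_on {0..1} (deriv01 G)"
proof -
  have "continuous_on {0..1} (deriv01 G)"
    using G by (auto simp: C11_def intro: lipschitz_on_continuous_on)
  moreover have "M-lipschitz_on {0<..<1} (deriv01 G)"
  proof (rule lipschitz_onI)
    fix x y :: real
    assume "x \<in> {0<..<1}" "y \<in> {0<..<1}"
    then show "dist (deriv01 G x) (deriv01 G y) \<le> M * dist x y"
      using deriv01_lipschitz_interior[OF assms, of x y] deriv01_lipschitz_interior[OF assms, of y x]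
      by (cases x y rule: linorder_cases) (auto simp: dist_real_def abs_minus_commute)
  qed (rule AE_le_of_Linf_norm_le(2)[OF g(2)])
  ultimately have "M-lipschitz_on (closure {0<..<1}) (deriv01 G)"
    by (intro lipschitz_on_closure) auto
  then show ?thesis
    by simp
qed

section \<open>Lower bounds for the Lipschitz constant of \<open>G'\<close>\<close>

text \<open>\<open>G - H\<close> is continuous with nonnegative derivative between \<open>u\<close>
  and \<open>v\<close>, hence nondecreasing. Only interior points are differentiated, since
  derivatives of \<open>G\<close> at 0 and 1 are one-sided.\<close>

lemma increment_ge:
  fixes G H :: "real \<Rightarrow> real"
  assumes G: "\<And>x. x \<in> {0..1} \<Longrightarrow> (G has_field_derivative h x) (at x within {0..1})"
    and H: "\<And>x. (H has_field_derivative k x) (at x)"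
    and le: "\<And>x. u \<le> x \<Longrightarrow> x \<le> v \<Longrightarrow> k x \<le> h x"
    and uv: "0 \<le> u" "u \<le> v" "v \<le> 1"
  shows "H v - H u \<le> G v - G u"
proof -
  have "G u - H u \<le> G v - H v"
  proof (rule DERIV_nonneg_imp_increasing_open[OF \<open>u \<le> v\<close>])
    fix x
    assume x: "u < x" "x < v"
    have "(G has_field_derivative h x) (at x)"
      using G[of x] x uv by (simp add: at_within_Icc_at)
    then have "((\<lambda>x. G x - H x) has_field_derivative h x - k x) (at x)"
      by (intro DERIV_diff H)
    then show "\<exists>y. ((\<lambda>x. G x - H x) has_field_derivative y) (at x) \<and> 0 \<le> y"
      using le[of x] x by auto
  next
    have "continuous_on {0..1} G"
      using G by (rule DERIV_continuous_on)
    then show "continuous_on {u..v} (\<lambda>x. G x - H x)"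
      using uv by (intro continuous_on_diff continuous_on_DERIV[OF H])
         (auto elim!: continuous_on_subset)
  qed
  then show ?thesis
    by simp
qed

text \<open>The Lipschitz condition puts \<open>h\<close> above the line of slope \<open>- M\<close>
  through its value at 0 and the line of slope \<open>M\<close> through its value at 1; both lines
  are integrated.\<close>

lemma lipschitz_deriv_increment_ge:
  fixes G h :: "real \<Rightarrow> real"
  assumes G: "\<And>x. x \<in> {0..1} \<Longrightarrow> (G has_field_derivative h x) (at x within {0..1})"
    and L: "M-lipschitz_on {0..1} h" and x: "x \<in> {0..1}"
  shows "h 0 * x - M * x\<^sup>2 / 2 \<le> G x - G 0"
    and "h 1 * (1 - x) - M * (1 - x)\<^sup>2 / 2 \<le> G 1 - G x"
proof -
  have lip: "h 0 - M * t \<le> h t" "h 1 - M * (1 - t) \<le> h t" if "t \<in> {0..1}" for t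
    using lipschitz_onD[OF L, of 0 t] lipschitz_onD[OF L, of 1 t] that
    by (auto simp: dist_real_def)
  have "((\<lambda>t. h 0 * t - M * t\<^sup>2 / 2) has_field_derivative h 0 - M * t) (at t)" for t
    by (auto intro!: derivative_eq_intros)
  from increment_ge[OF G this, of 0 x] show "h 0 * x - M * x\<^sup>2 / 2 \<le> G x - G 0"
    using lip(1) x by auto
  have "((\<lambda>t. - (h 1 * (1 - t) - M * (1 - t)\<^sup>2 / 2)) has_field_derivative h 1 - M * (1 - t)) (at t)" for t
    by (auto intro!: derivative_eq_intros simp: field_simps)
  from increment_ge[OF G this, of x 1] show "h 1 * (1 - x) - M * (1 - x)\<^sup>2 / 2 \<le> G 1 - G x"
    using lip(2) x by auto
qed

text \<open>The two increment estimates are added at the crossing point of the two lines, where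
  their sum is strongest.\<close>

lemma lipschitz_deriv_quadratic:
  fixes G h :: "real \<Rightarrow> real"
  assumes G: "\<And>x. x \<in> {0..1} \<Longrightarrow> (G has_field_derivative h x) (at x within {0..1})"
    and L: "M-lipschitz_on {0..1} h"
  defines "d \<equiv> 2 * (G 1 - G 0) - h 0 - h 1"
  shows "- M \<le> d" and "0 \<le> M\<^sup>2 + 2 * M * d - (h 1 - h 0)\<^sup>2"
proof -
  have inc: "h 0 * x - M * x\<^sup>2 / 2 \<le> G x - G 0" "h 1 * (1 - x) - M * (1 - x)\<^sup>2 / 2 \<le> G 1 - G x"
    if "x \<in> {0..1}" for x
    by (rule lipschitz_deriv_increment_ge[OF G L that], assumption)+
  \<comment> \<open>Each line alone, integrated over the whole interval, bounds
    \<open>G 1 - G 0\<close>; the two bounds are added.\<close>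
  show "- M \<le> d"
    using inc(1)[of 1] inc(2)[of 0] by (simp add: d_def)
  have "M \<ge> 0"
    using L by (rule lipschitz_on_nonneg)
  have diff: "\<bar>h 1 - h 0\<bar> \<le> M"
    using lipschitz_onD[OF L, of 1 0] by (simp add: dist_real_def)
  show "0 \<le> M\<^sup>2 + 2 * M * d - (h 1 - h 0)\<^sup>2"
  proof (cases "M = 0")
    case False
    then have "M > 0"
      using \<open>M \<ge> 0\<close> by simp
    \<comment> \<open>where the lines \<open>h 0 - M * x\<close> and \<open>h 1 - M * (1 - x)\<close> cross\<close>
    define x where "x = (h 0 - h 1 + M) / (2 * M)"
    have x: "x \<in> {0..1}" and Mx: "M * x = (h 0 - h 1 + M) / 2"
      using diff \<open>M > 0\<close> by (auto simp: x_def field_simps)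
    have "h 0 * x - M * x\<^sup>2 / 2 + (h 1 * (1 - x) - M * (1 - x)\<^sup>2 / 2) \<le> G 1 - G 0"
      using inc[OF x] by simp
    \<comment> \<open>Multiplication by \<open>M\<close> leaves an expression in
      \<open>M * x\<close>, whose value is free of denominators in \<open>M\<close>.\<close>
    then have "M * (h 0 * x - M * x\<^sup>2 / 2 + (h 1 * (1 - x) - M * (1 - x)\<^sup>2 / 2)) \<le> M * (G 1 - G 0)"
      using \<open>M > 0\<close> by simp
    moreover have "M * (h 0 * x - M * x\<^sup>2 / 2 + (h 1 * (1 - x) - M * (1 - x)\<^sup>2 / 2)) =
        h 0 * (M * x) - (M * x)\<^sup>2 / 2 + h 1 * (M - M * x) - (M - M * x)\<^sup>2 / 2"
      by (simp add: power2_eq_square algebra_simps)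
    ultimately show ?thesis
      unfolding Mx d_def by (simp add: power2_eq_square field_simps)
  qed (use diff in simp)
qed

text \<open>The quadratic whose linear term is \<open>- 2 * M * \<bar>d\<bar>\<close> reads
  \<open>d\<^sup>2 + e\<^sup>2 \<le> (M - \<bar>d\<bar>)\<^sup>2\<close>, and
  \<open>\<bar>d\<bar> \<le> M\<close> fixes the sign of the root.\<close>

lemma quadratic_root_le:
  fixes M d e :: real
  assumes "\<bar>d\<bar> \<le> M" "0 \<le> M\<^sup>2 + 2 * M * d - e\<^sup>2" "0 \<le> M\<^sup>2 - 2 * M * d - e\<^sup>2"
  shows "\<bar>d\<bar> + sqrt (d\<^sup>2 + e\<^sup>2) \<le> M"
proof -
  have "d\<^sup>2 + e\<^sup>2 \<le> (M - \<bar>d\<bar>)\<^sup>2"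
    using assms by (cases "d \<ge> 0") (simp_all add: power2_eq_square algebra_simps)
  then have "sqrt (d\<^sup>2 + e\<^sup>2) \<le> M - \<bar>d\<bar>"
    using assms(1) by (intro real_le_lsqrt) auto
  then show ?thesis
    by simp
qed

text \<open>Replacing \<open>G\<close> by \<open>- G\<close> flips the sign of \<open>d\<close> and
  preserves \<open>(h 1 - h 0)\<^sup>2\<close>, so both quadratic inequalities are
  available.\<close>

lemma lipschitz_deriv_ge_root:
  fixes G h :: "real \<Rightarrow> real"
  assumes G: "\<And>x. x \<in> {0..1} \<Longrightarrow> (G has_field_derivative h x) (at x within {0..1})"
    and L: "M-lipschitz_on {0..1} h"
  defines "d \<equiv> 2 * (G 1 - G 0) - h 0 - h 1"
  shows "\<bar>d\<bar> + sqrt (d\<^sup>2 + (h 1 - h 0)\<^sup>2) \<le> M"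
proof (rule quadratic_root_le)
  have "M-lipschitz_on {0..1} (\<lambda>x. - h x)"
    using L by (simp add: lipschitz_on_def dist_real_def abs_minus_commute)
  note neg = lipschitz_deriv_quadratic[of "\<lambda>x. - G x" "\<lambda>x. - h x", OF DERIV_minus[OF G] this]
  note pos = lipschitz_deriv_quadratic[OF G L]
  show "\<bar>d\<bar> \<le> M"
    using pos(1) neg(1) by (simp add: d_def)
  show "0 \<le> M\<^sup>2 + 2 * M * d - (h 1 - h 0)\<^sup>2"
    using pos(2) by (simp add: d_def)
  show "0 \<le> M\<^sup>2 - 2 * M * d - (h 1 - h 0)\<^sup>2"
    using neg(2) by (simp add: d_def algebra_simps power2_commute)
qed

text \<open>The two lines below \<open>h\<close> reach zero at \<open>x = h 0 / M\<close> and
  \<open>y = 1 - h 1 / M\<close>, and \<open>h 0 + h 1 \<le> M\<close> says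
  \<open>x \<le> y\<close>. The triangles they cut off have areas
  \<open>(h 0)\<^sup>2 / (2 * M)\<close> and \<open>(h 1)\<^sup>2 / (2 * M)\<close>, and
  \<open>G\<close> does not decrease in between.\<close>

lemma lipschitz_nonneg_deriv_ge:
  fixes G h :: "real \<Rightarrow> real"
  assumes G: "\<And>x. x \<in> {0..1} \<Longrightarrow> (G has_field_derivative h x) (at x within {0..1})"
    and L: "M-lipschitz_on {0..1} h" and nonneg: "\<And>x. x \<in> {0..1} \<Longrightarrow> 0 \<le> h x"
    and M: "h 0 + h 1 \<le> M"
  shows "(h 0)\<^sup>2 + (h 1)\<^sup>2 \<le> M * (2 * (G 1 - G 0))"
proof (cases "M = 0")
  case True
  then have "h 0 = 0" "h 1 = 0"
    using M nonneg[of 0] nonneg[of 1] by simp_all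
  then show ?thesis
    using True by simp
next
  case False
  have h: "0 \<le> h 0" "0 \<le> h 1"
    using nonneg by auto
  then have "M > 0"
    using False M by simp
  define x y where "x = h 0 / M" and "y = 1 - h 1 / M"
  have xy: "0 \<le> x" "x \<le> y" "y \<le> 1"
    using h M \<open>M > 0\<close> by (auto simp: x_def y_def field_simps)
  have Mxy: "M * x = h 0" "M * (1 - y) = h 1"
    using \<open>M > 0\<close> by (simp_all add: x_def y_def)
  have "0 - 0 \<le> G y - G x"
    by (rule increment_ge[OF G, where H = "\<lambda>_. 0" and k = "\<lambda>_. 0"]) (use xy nonneg in auto)
  then have "h 0 * x - M * x\<^sup>2 / 2 + (h 1 * (1 - y) - M * (1 - y)\<^sup>2 / 2) \<le> G 1 - G 0"
    using lipschitz_deriv_increment_ge(1)[OF G L, of x] lipschitz_deriv_increment_ge(2)[OF G L, of y] xy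
    by simp
  then have "M * (h 0 * x - M * x\<^sup>2 / 2 + (h 1 * (1 - y) - M * (1 - y)\<^sup>2 / 2)) \<le> M * (G 1 - G 0)"
    using \<open>M > 0\<close> by simp
  moreover have "M * (h 0 * x - M * x\<^sup>2 / 2 + (h 1 * (1 - y) - M * (1 - y)\<^sup>2 / 2)) =
      h 0 * (M * x) - (M * x)\<^sup>2 / 2 + h 1 * (M * (1 - y)) - (M * (1 - y))\<^sup>2 / 2"
    by (simp add: power2_eq_square algebra_simps)
  ultimately show ?thesis
    unfolding Mxy by (simp add: power2_eq_square right_diff_distrib)
qed

text \<open>It suffices to compare \<open>V\<close> with the real upper bounds \<open>M\<close> of
  each \<open>Linf_norm g\<close>; an infinite norm has none and satisfies the bound
  trivially.\<close>

lemma M_star_geI: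
  assumes "\<And>G M. \<lbrakk>\<And>x. x \<in> {0..1} \<Longrightarrow> (G has_field_derivative deriv01 G x) (at x within {0..1});
      M-lipschitz_on {0..1} (deriv01 G); G 0 = 0; G 1 = c; deriv01 G 0 = a; deriv01 G 1 = b;
      \<And>x. x \<in> {0..1} \<Longrightarrow> 0 \<le> deriv01 G x\<rbrakk> \<Longrightarrow> V \<le> ereal M"
  shows "V \<le> M_star a b c"
proof -
  have "V \<le> Linf_norm g"
    if *: "G \<in> C11" "G 0 = 0" "G 1 = c" "deriv01 G 0 = a" "deriv01 G 1 = b"
      "\<forall>x\<in>{0..1}. 0 \<le> deriv01 G x" "distr_second_deriv G g" for G g
  proof (rule ereal_le_real)
    fix M
    assume "Linf_norm g \<le> ereal M"
    then show "V \<le> ereal M"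
      using * by (intro assms[of G] C11_DERIV deriv01_lipschitz) auto
  qed
  then show ?thesis
    unfolding M_star_def Linf_norm_second_deriv_def by (blast intro!: Inf_greatest)
qed

section \<open>Competitors with piecewise linear derivative\<close>

text \<open>A primitive of the positive part of \<open>x - p\<close>, so that its second derivative
  is the unit step at \<open>p\<close>.\<close>

definition kink :: "real \<Rightarrow> real \<Rightarrow> real" where
  "kink p x = (max 0 (x - p))\<^sup>2 / 2"

lemma DERIV_max_0:
  fixes x p :: real
  assumes "x \<noteq> p"
  shows "((\<lambda>x. max 0 (x - p)) has_field_derivative (if x \<ge> p then 1 else 0)) (at x)"
proof (cases "x > p")
  case True
  have "((\<lambda>x. x - p) has_field_derivative 1) (at x)"
    by (auto intro!: derivative_eq_intros)
  then show ?thesis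
    using True
    by (auto intro: has_field_derivative_transform_within_open[where S = "{p<..}"])
next
  case False
  have "((\<lambda>x. 0) has_field_derivative 0) (at x)"
    by simp
  then show ?thesis
    by (rule DERIV_cong[OF has_field_derivative_transform_within_open[where S = "{..<p}"]])
      (use False assms in auto)
qed

lemma DERIV_kink: "(kink p has_field_derivative max 0 (x - p)) (at x)"
proof (cases "x = p")
  case True
  have "((\<lambda>x. (x - p)\<^sup>2) has_field_derivative 0) (at x)"
    using True by (auto intro!: derivative_eq_intros)
  then show ?thesis
    using True has_field_derivative_zero_dominated[of "\<lambda>x. (x - p)\<^sup>2" x "kink p"]
    by (simp add: kink_def max_def)
next
  case False
  have "(kink p has_field_derivative max 0 (x - p) * (if x \<ge> p then 1 else 0)) (at x)"
    unfolding kink_def[abs_def]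
    by (rule DERIV_cong[OF DERIV_cdivide[OF DERIV_power[OF DERIV_max_0[OF False]]]]) simp
  then show ?thesis
    by (rule DERIV_cong) simp
qed

text \<open>The competitor has second derivative \<open>k\<close>, lowered by \<open>k\<close> at each of \<open>p\<close> and \<open>q\<close>.\<close>

lemma M_star_le:
  fixes a k p q :: real
  assumes pq: "p \<in> {0..1}" "q \<in> {0..1}"
    and nonneg: "\<And>x. x \<in> {0..1} \<Longrightarrow> 0 \<le> a + k * (x - max 0 (x - p) - max 0 (x - q))"
    and b: "b = a - k + k * (p + q)"
    and c: "c = a + k / 2 - k * ((1 - p)\<^sup>2 + (1 - q)\<^sup>2) / 2"
  shows "M_star a b c \<le> ereal \<bar>k\<bar>"
proof -
  define G where "G x = a * x + k * (x\<^sup>2 / 2 - kink p x - kink q x)" for x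
  define h where "h x = a + k * (x - max 0 (x - p) - max 0 (x - q))" for x
  \<comment> \<open>The values are \<open>k\<close>, 0 and \<open>- k\<close> only; the middle one
    disappears when \<open>p = q\<close>.\<close>
  define g where "g x = k * (1 - (if x \<ge> p then 1 else 0) - (if x \<ge> q then 1 else 0))" for x
  have G': "(G has_field_derivative h x) (at x)" for x
    unfolding G_def h_def by (auto intro!: derivative_eq_intros DERIV_kink)
  have h': "(h has_field_derivative g x) (at x)" if "x \<notin> {p, q}" for x
    unfolding h_def g_def using that by (auto intro!: derivative_eq_intros DERIV_max_0)
  have d01: "deriv01 G x = h x" if "x \<in> {0..1}" for x
    using that by (intro deriv01_eqI DERIV_subset[OF G']) auto
  \<comment> \<open>The crude constant 3 serves only for membership in \<open>C11\<close>; the sharp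
    bound comes from \<open>g\<close>.\<close>
  have lip: "\<bar>h x - h y\<bar> \<le> 3 * \<bar>k\<bar> * \<bar>x - y\<bar>" for x y
  proof -
    have *: "\<bar>(x - P - Q) - (y - P' - Q')\<bar> \<le> 3 * \<bar>x - y\<bar>"
      if "\<bar>P - P'\<bar> \<le> \<bar>x - y\<bar>" "\<bar>Q - Q'\<bar> \<le> \<bar>x - y\<bar>" for P Q P' Q'
      using that by (smt (verit))
    have "\<bar>max 0 (x - r) - max 0 (y - r)\<bar> \<le> \<bar>x - y\<bar>" for r
      by (auto simp: max_def)
    from *[OF this[of p] this[of q]]
    have "\<bar>(x - max 0 (x - p) - max 0 (x - q)) - (y - max 0 (y - p) - max 0 (y - q))\<bar> \<le> 3 * \<bar>x - y\<bar>" .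
    then have "\<bar>k\<bar> * \<bar>(x - max 0 (x - p) - max 0 (x - q)) - (y - max 0 (y - p) - max 0 (y - q))\<bar> \<le> \<bar>k\<bar> * (3 * \<bar>x - y\<bar>)"
      by (intro mult_left_mono) auto
    then show ?thesis
      by (simp add: h_def abs_mult[symmetric] algebra_simps)
  qed
  have "(3 * \<bar>k\<bar>)-lipschitz_on {0..1} (deriv01 G)"
    using lip by (auto intro!: lipschitz_onI simp: dist_real_def d01)
  moreover have "G differentiable_on {0..1}"
    using G' unfolding differentiable_on_def
    by (meson differentiable_at_withinI field_differentiable_def field_differentiable_imp_differentiable)
  ultimately have "G \<in> C11"
    by (auto simp: C11_def)
  have g: "g \<in> borel_measurable borel"
    unfolding g_def[abs_def] by measurable
  have g_le: "\<bar>g x\<bar> \<le> \<bar>k\<bar>" for x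
    by (simp add: g_def)
  have "distr_second_deriv G g"
  proof (rule distr_second_derivI[where N = "{p, q}", OF G' h' _ _ g g_le])
    show "continuous_on UNIV h"
      unfolding h_def[abs_def] by (intro continuous_intros)
  qed auto
  then have "Linf_norm_second_deriv G \<le> Linf_norm g"
    unfolding Linf_norm_second_deriv_def by (intro Inf_lower) auto
  also have "\<dots> \<le> ereal \<bar>k\<bar>"
    using g g_le by (rule Linf_norm_le)
  finally have "Linf_norm_second_deriv G \<le> ereal \<bar>k\<bar>" .
  moreover have "M_star a b c \<le> Linf_norm_second_deriv G"
    unfolding M_star_def
  proof (rule Inf_lower, rule CollectI, intro exI conjI refl)
    have kink: "kink r 0 = 0" "kink r 1 = (1 - r)\<^sup>2 / 2" if "r \<in> {0..1}" for r
      using that by (auto simp: kink_def)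
    show "G 0 = 0" "G 1 = c"
      by (simp_all add: G_def kink[OF pq(1)] kink[OF pq(2)] c algebra_simps add_divide_distrib)
    show "deriv01 G 0 = a" "deriv01 G 1 = b" "\<forall>x\<in>{0..1}. 0 \<le> deriv01 G x"
      using pq nonneg by (simp_all add: d01 h_def b algebra_simps)
  qed (simp_all add: \<open>G \<in> C11\<close>)
  ultimately show ?thesis
    by (rule order_trans[rotated])
qed

text \<open>The competitor has \<open>p = q\<close>: its derivative is a tent if
  \<open>d \<ge> 0\<close> and a V if \<open>d < 0\<close>. The bottom of the V has height
  \<open>(a + b - M) / 2\<close>, which \<open>le\<close> keeps nonnegative.\<close>

lemma M_star_le_root:
  fixes a b c :: real
  defines "d \<equiv> 2 * c - a - b"
  assumes "0 \<le> a" "0 \<le> b"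
    and le: "d < 0 \<Longrightarrow> \<bar>d\<bar> + sqrt (d\<^sup>2 + (b - a)\<^sup>2) \<le> a + b"
  shows "M_star a b c \<le> ereal (\<bar>d\<bar> + sqrt (d\<^sup>2 + (b - a)\<^sup>2))"
proof -
  define M where "M = \<bar>d\<bar> + sqrt (d\<^sup>2 + (b - a)\<^sup>2)"
  define k where "k = (if d < 0 then - M else M)"
  have "M \<ge> 0"
    by (simp add: M_def)
  then have k: "\<bar>k\<bar> = M"
    by (simp add: k_def)
  have "(M - \<bar>d\<bar>)\<^sup>2 = d\<^sup>2 + (b - a)\<^sup>2"
    by (simp add: M_def)
  \<comment> \<open>This is the equation that gives the competitor the value \<open>c\<close> at
    1.\<close>
  then have quad: "k\<^sup>2 - 2 * k * d = (b - a)\<^sup>2"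
    by (simp add: k_def power2_eq_square algebra_simps split: if_splits)
  have ba: "\<bar>b - a\<bar> \<le> \<bar>k\<bar>"
    using real_sqrt_ge_abs2[of "b - a" d] unfolding k M_def by linarith
  have "M_star a b c \<le> ereal \<bar>k\<bar>"
  proof (cases "k = 0")
    \<comment> \<open>Here \<open>d = 0\<close> and \<open>a = b\<close>, so the competitor is
      linear.\<close>
    case True
    then have "b = a" "c = a"
      using ba k \<open>M \<ge> 0\<close> by (auto simp: M_def d_def add_nonneg_eq_0_iff)
    then show ?thesis
      using M_star_le[of 0 0 a 0 b c] True \<open>0 \<le> a\<close> by simp
  next
    case False
    \<comment> \<open>Slope \<open>k\<close> up to \<open>p\<close> and \<open>- k\<close>
      afterwards leads from \<open>a\<close> to \<open>b\<close> exactly for this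
      \<open>p\<close>.\<close>
    define p where "p = (b - a + k) / (2 * k)"
    have kp: "k * p = (b - a + k) / 2"
      using False by (simp add: p_def)
    have p: "p \<in> {0..1}"
      using ba False by (cases "k > 0") (auto simp: p_def field_simps)
    show ?thesis
    proof (rule M_star_le[OF p p])
      show "b = a - k + k * (p + p)"
        using kp by (simp add: algebra_simps)
      have "k * (a + k / 2 - k * ((1 - p)\<^sup>2 + (1 - p)\<^sup>2) / 2) = k * a + k\<^sup>2 / 2 - (k - k * p)\<^sup>2"
        by (simp add: power2_eq_square field_simps)
      also have "\<dots> = k * c"
        unfolding kp using quad by (simp add: d_def power2_eq_square field_simps)
      finally show "c = a + k / 2 - k * ((1 - p)\<^sup>2 + (1 - p)\<^sup>2) / 2"
        using False by simp
    next
      fix x :: real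
      assume x: "x \<in> {0..1}"
      have eq: "k * (x - max 0 (x - p) - max 0 (x - p)) = (if x \<le> p then k * x else 2 * (k * p) - k * x)"
        by (simp add: algebra_simps)
      show "0 \<le> a + k * (x - max 0 (x - p) - max 0 (x - p))"
      proof (cases "d < 0")
        case True
        then have "k \<le> 0" "- k \<le> a + b"
          using le k \<open>M \<ge> 0\<close> by (auto simp: k_def M_def)
        then have "k * p \<le> k * x" if "x \<le> p"
          using that by (intro mult_left_mono_neg)
        moreover have "k * x \<le> k * p" if "p \<le> x"
          using that \<open>k \<le> 0\<close> by (intro mult_left_mono_neg)
        ultimately show ?thesis
          unfolding eq using \<open>- k \<le> a + b\<close> kp by auto
      next
        case False
        then have "k \<ge> 0"
          using \<open>M \<ge> 0\<close> by (simp add: k_def)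
        then have "0 \<le> k * x" "k * x \<le> k"
          using x by (auto intro: mult_left_le)
        then show ?thesis
          unfolding eq using kp \<open>0 \<le> a\<close> \<open>0 \<le> b\<close> by auto
      qed
    qed
  qed
  then show ?thesis
    by (simp add: k M_def)
qed

text \<open>The derivative falls with slope \<open>- M\<close> from \<open>a\<close> to 0, stays at
  0, and rises with slope \<open>M\<close> to \<open>b\<close>; the two triangles have total area
  \<open>(a\<^sup>2 + b\<^sup>2) / (2 * M) = c\<close>. The assumption \<open>c\<close> amounts to
  \<open>a + b \<le> M\<close>, so the triangles fit side by side.\<close>

lemma M_star_le_ratio:
  fixes a b c :: real
  assumes "0 \<le> a" "0 \<le> b" "0 < a + b" "0 < c" and c: "2 * c * (a + b) \<le> a\<^sup>2 + b\<^sup>2"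
  shows "M_star a b c \<le> ereal ((a\<^sup>2 + b\<^sup>2) / (2 * c))"
proof -
  define M where "M = (a\<^sup>2 + b\<^sup>2) / (2 * c)"
  have "M > 0"
    using \<open>0 < a + b\<close> \<open>0 < c\<close> by (auto simp: M_def sum_power2_gt_zero_iff)
  have "a + b \<le> M"
    using c \<open>0 < c\<close> by (simp add: M_def field_simps)
  have "M_star a b c \<le> ereal \<bar>- M\<bar>"
  proof (rule M_star_le)
    show "a / M \<in> {0..1}" "1 - b / M \<in> {0..1}"
      using assms(1,2) \<open>M > 0\<close> \<open>a + b \<le> M\<close> by auto
    show "b = a - - M + - M * (a / M + (1 - b / M))"
      using \<open>M > 0\<close> by (simp add: field_simps)
    have "a + - M / 2 - - M * ((1 - a / M)\<^sup>2 + (1 - (1 - b / M))\<^sup>2) / 2 = (a\<^sup>2 + b\<^sup>2) / (2 * M)"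
      using \<open>M > 0\<close> by (simp add: power2_eq_square field_simps)
    also have "\<dots> = c"
    proof -
      have "a\<^sup>2 + b\<^sup>2 = c * (2 * M)"
        using \<open>0 < c\<close> by (simp add: M_def)
      then show ?thesis
        using \<open>M > 0\<close> by simp
    qed
    finally show "c = a + - M / 2 - - M * ((1 - a / M)\<^sup>2 + (1 - (1 - b / M))\<^sup>2) / 2" ..
  next
    fix x :: real
    \<comment> \<open>The first two terms form \<open>min x (a / M)\<close>, and the last one only
      lowers the value.\<close>
    have "x - max 0 (x - a / M) - max 0 (x - (1 - b / M)) \<le> a / M"
      by simp
    then have "M * (x - max 0 (x - a / M) - max 0 (x - (1 - b / M))) \<le> M * (a / M)"
      using \<open>M > 0\<close> by (intro mult_left_mono) auto
    then show "0 \<le> a + - M * (x - max 0 (x - a / M) - max 0 (x - (1 - b / M)))"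
      using \<open>M > 0\<close> by simp
  qed
  then show ?thesis
    using \<open>M > 0\<close> unfolding M_def[symmetric] by simp
qed

section \<open>The threshold \<open>c_zero\<close> and the two cases\<close>

lemma abs_plus_sqrt_mono:
  fixes d d' e :: real
  assumes "\<bar>d\<bar> \<le> \<bar>d'\<bar>"
  shows "\<bar>d\<bar> + sqrt (d\<^sup>2 + e) \<le> \<bar>d'\<bar> + sqrt (d'\<^sup>2 + e)"
  using assms by (intro add_mono real_sqrt_le_mono) (auto simp: abs_le_square_iff)

text \<open>For \<open>a + b > 0\<close> one has \<open>d = - 2 * a * b / (a + b)\<close>, and the
  root equals \<open>(a\<^sup>2 + b\<^sup>2) / (a + b)\<close> by the Pythagorean identity for
  \<open>2 * a * b\<close> and \<open>b\<^sup>2 - a\<^sup>2\<close>.\<close>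

lemma root_at_c_zero:
  fixes a b :: real
  assumes "0 \<le> a" "0 \<le> b"
  defines "d \<equiv> 2 * c_zero a b - a - b"
  shows "d \<le> 0" and "\<bar>d\<bar> + sqrt (d\<^sup>2 + (b - a)\<^sup>2) = a + b"
proof -
  have "d \<le> 0 \<and> \<bar>d\<bar> + sqrt (d\<^sup>2 + (b - a)\<^sup>2) = a + b"
  proof (cases "a + b = 0")
    case True
    \<comment> \<open>Division by zero yields \<open>c_zero a b = 0\<close>, so
      \<open>d = 0\<close>.\<close>
    then show ?thesis
      using assms(1,2) by (simp add: d_def c_zero_def add_nonneg_eq_0_iff)
  next
    case False
    then have s: "a + b > 0"
      using assms(1,2) by simp
    have d: "d = - (2 * a * b / (a + b))"
      using s by (simp add: d_def c_zero_def power2_eq_square field_simps)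
    then have "d \<le> 0"
      using assms(1,2) by simp
    have "d\<^sup>2 + (b - a)\<^sup>2 = ((a\<^sup>2 + b\<^sup>2) / (a + b))\<^sup>2"
    proof -
      have "d\<^sup>2 + (b - a)\<^sup>2 = ((2 * a * b)\<^sup>2 + ((b - a) * (a + b))\<^sup>2) / (a + b)\<^sup>2"
        using s by (simp add: d power_divide power_mult_distrib add_divide_distrib)
      also have "(2 * a * b)\<^sup>2 + ((b - a) * (a + b))\<^sup>2 = (a\<^sup>2 + b\<^sup>2)\<^sup>2"
        by (simp add: power2_eq_square algebra_simps)
      finally show ?thesis
        by (simp add: power_divide)
    qed
    then have "sqrt (d\<^sup>2 + (b - a)\<^sup>2) = (a\<^sup>2 + b\<^sup>2) / (a + b)"
      using s by simp
    moreover have "2 * a * b / (a + b) + (a\<^sup>2 + b\<^sup>2) / (a + b) = a + b"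
    proof -
      have "2 * a * b + (a\<^sup>2 + b\<^sup>2) = (a + b) * (a + b)"
        by (simp add: power2_eq_square algebra_simps)
      then show ?thesis
        using s by (simp add: add_divide_distrib[symmetric])
    qed
    moreover have "\<bar>d\<bar> = 2 * a * b / (a + b)"
      using \<open>d \<le> 0\<close> d by linarith
    ultimately show ?thesis
      using \<open>d \<le> 0\<close> by linarith
  qed
  then show "d \<le> 0" and "\<bar>d\<bar> + sqrt (d\<^sup>2 + (b - a)\<^sup>2) = a + b"
    by auto
qed

lemma M_star_ge_root:
  "ereal (\<bar>2 * c - a - b\<bar> + sqrt ((2 * c - a - b)\<^sup>2 + (b - a)\<^sup>2)) \<le> M_star a b c"
proof (rule M_star_geI)
  fix G M
  assume "\<And>x. x \<in> {0..1} \<Longrightarrow> (G has_field_derivative deriv01 G x) (at x within {0..1})"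
    "M-lipschitz_on {0..1} (deriv01 G)" "G 0 = 0" "G 1 = c" "deriv01 G 0 = a" "deriv01 G 1 = b"
  then show "ereal (\<bar>2 * c - a - b\<bar> + sqrt ((2 * c - a - b)\<^sup>2 + (b - a)\<^sup>2)) \<le> ereal M"
    using lipschitz_deriv_ge_root[of G "deriv01 G" M] by simp
qed

text \<open>For \<open>c \<le> c_zero a b\<close> the deviation
  \<open>\<bar>2 * c - a - b\<bar>\<close> is at least its value at the threshold, so the root bound
  forces \<open>a + b \<le> M\<close>; this is what the estimate using \<open>G' \<ge> 0\<close>
  requires.\<close>

lemma M_star_ge_ratio:
  assumes "0 \<le> a" "0 \<le> b" "0 \<le> c" "c \<le> c_zero a b"
  shows "ereal (a\<^sup>2 + b\<^sup>2) / ereal (2 * c) \<le> M_star a b c"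
proof (rule M_star_geI)
  fix G M
  assume *: "\<And>x. x \<in> {0..1} \<Longrightarrow> (G has_field_derivative deriv01 G x) (at x within {0..1})"
    "M-lipschitz_on {0..1} (deriv01 G)" "G 0 = 0" "G 1 = c" "deriv01 G 0 = a" "deriv01 G 1 = b"
    "\<And>x. x \<in> {0..1} \<Longrightarrow> 0 \<le> deriv01 G x"
  have "\<bar>2 * c - a - b\<bar> + sqrt ((2 * c - a - b)\<^sup>2 + (b - a)\<^sup>2) \<le> M"
    using lipschitz_deriv_ge_root[of G "deriv01 G" M] *(1-6) by simp
  moreover have "a + b \<le> \<bar>2 * c - a - b\<bar> + sqrt ((2 * c - a - b)\<^sup>2 + (b - a)\<^sup>2)"
    unfolding root_at_c_zero(2)[OF assms(1,2), symmetric]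
    by (rule abs_plus_sqrt_mono) (use root_at_c_zero(1)[OF assms(1,2)] assms(4) in simp)
  ultimately have "a\<^sup>2 + b\<^sup>2 \<le> M * (2 * c)"
    using lipschitz_nonneg_deriv_ge[of G "deriv01 G" M] * by simp
  moreover have "0 \<le> M"
    using *(2) by (rule lipschitz_on_nonneg)
  \<comment> \<open>If \<open>c = 0\<close>, the inequality forces \<open>a = b = 0\<close>, and the
    quotient is \<open>0 / 0 = 0\<close>.\<close>
  ultimately show "ereal (a\<^sup>2 + b\<^sup>2) / ereal (2 * c) \<le> ereal M"
    using assms(3) by (cases "c = 0") (auto simp: divide_le_eq sum_power2_le_zero_iff zero_ereal_def[symmetric])
qed

theorem theorem2p1:
  fixes a b c :: real
  assumes "a \<ge> 0" and "b \<ge> 0" and "c \<ge> 0"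
  shows "(c \<le> c_zero a b \<longrightarrow> M_star a b c = ereal (a\<^sup>2 + b\<^sup>2) / ereal (2 * c)) \<and>
         (c \<ge> c_zero a b \<longrightarrow>
            M_star a b c = ereal (\<bar>2 * c - a - b\<bar> + sqrt ((2 * c - a - b)\<^sup>2 + (b - a)\<^sup>2))) \<and>
         M_star a b (c_zero a b) = ereal (a + b)"
proof -
  note at_c_zero = root_at_c_zero[OF assms(1,2)]
  \<comment> \<open>Stated for all \<open>c\<close> above the threshold, since it is also applied at
    \<open>c_zero a b\<close> and at 0.\<close>
  have root: "M_star a b c = ereal (\<bar>2 * c - a - b\<bar> + sqrt ((2 * c - a - b)\<^sup>2 + (b - a)\<^sup>2))"
    if "c \<ge> c_zero a b" for c
  proof (rule antisym[OF M_star_le_root M_star_ge_root])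
    \<comment> \<open>Between the threshold and \<open>(a + b) / 2\<close> the deviation shrinks as
      \<open>c\<close> grows, so the root stays below its threshold value
      \<open>a + b\<close>.\<close>
    assume "2 * c - a - b < 0"
    then show "\<bar>2 * c - a - b\<bar> + sqrt ((2 * c - a - b)\<^sup>2 + (b - a)\<^sup>2) \<le> a + b"
      unfolding at_c_zero(2)[symmetric]
      by (intro abs_plus_sqrt_mono) (use that in simp)
  qed (use assms in auto)
  have "M_star a b c = ereal (a\<^sup>2 + b\<^sup>2) / ereal (2 * c)" if c: "c \<le> c_zero a b"
  proof (rule antisym[OF _ M_star_ge_ratio])
    show "M_star a b c \<le> ereal (a\<^sup>2 + b\<^sup>2) / ereal (2 * c)"
    proof (cases "c = 0")
      case False
      then have "a + b > 0"
        \<comment> \<open>If \<open>a + b = 0\<close>, then \<open>c_zero a b = 0\<close>, which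
          contradicts \<open>c > 0\<close>.\<close>
        using c assms by (cases "a + b = 0") (auto simp: c_zero_def)
      then have "2 * c * (a + b) \<le> a\<^sup>2 + b\<^sup>2"
        using c by (simp add: c_zero_def field_simps)
      then show ?thesis
        using M_star_le_ratio[of a b c] assms False \<open>a + b > 0\<close> by simp
    next
      case True
      \<comment> \<open>At \<open>c = 0\<close> the quotient is \<open>\<infinity>\<close> unless
        \<open>a = b = 0\<close>, where \<open>0 / 0 = 0\<close> agrees with the root
        formula.\<close>
      show ?thesis
      proof (cases "a = 0 \<and> b = 0")
        case True
        then show ?thesis
          using root[of 0] \<open>c = 0\<close> by (simp add: c_zero_def zero_ereal_def[symmetric])
      next
        case False
        then have "ereal (a\<^sup>2 + b\<^sup>2) / ereal (2 * c) = \<infinity>"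
          using \<open>c = 0\<close> by (simp add: sum_power2_gt_zero_iff zero_ereal_def[symmetric] divide_ereal_def)
        then show ?thesis
          by simp
      qed
    qed
  qed (use assms c in auto)
  then show ?thesis
    using root root[of "c_zero a b"] at_c_zero(2) by simp
qed

end
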